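(* Let $\alpha>0$ be an irrational number, let $d\ge 1$, let $N_1,\ldots,N_d$ be positive integers and let $n_1,\ldots,n_d$ be non-negative integers such that $n_i\le N_i$ for $1\le i\le d$. Write $N=\sum_{i=1}^d (N_i-n_i)$. Let $q\in\mathbb{Z}_{>0}$ and, for $1\le i\le d$, let $0\ne p_i\in\mathbb{Z}$ and $k_i\in\mathbb{R}$, and consider the maps $\hat f_i:\mathbb{R}\to\mathbb{R}$, $\hat f_i(x)=\frac{p_i}{q}x+k_i$. Fix a positive rational number $P$ and let $\lambda$ be any positive integer multiple of $Pq$. Let $\{-\}_\lambda$ denote either one of the two $\lambda$-fractional part functions $\{-\}'_\lambda$, $\{-\}''_\lambda$ (defined in the context), and define $f_i:\mathbb{R}\to\mathbb{R}$ by $f_i(x)=\hat f_i(\{x\}_\lambda)$. Insert mod $P$ the values $f_i(m\alpha)$, $n_i<m\le N_i$, $1\le i\le d$, in the interval $[0,P)$ to form an increasing sequence $(b_n)_{1\le n\le N}$. Write $\ell=\mathrm{lcm}(p_1,\ldots,p_d)>0$, $c_i=\ell/p_i$ and $c=\sum_{i=1}^d |c_i|$. Then there are at most $3c$ distinct values in the set of gaps $g_m$, $1\le m\le N$, defined by $$g_1=P+b_1-b_N,\qquad g_m=b_m-b_{m-1},\quad m=2,\ldots,N.$$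
   Context: For a positive rational $\lambda$, let $I_\lambda=\{n\lambda\mid n\in\mathbb{Z}\}$, and for $x\in\mathbb{R}$ define $\lfloor x\rfloor_\lambda=\max\{r\in I_\lambda\mid r\le x\}$ and $\lceil x\rceil_\lambda=\min\{r\in I_\lambda\mid r\ge x\}$. The two $\lambda$-fractional part functions are $$\{x\}'_\lambda=\begin{cases} x-\lfloor x\rfloor_\lambda & \text{if } x\ge 0,\\ x-\lceil x\rceil_\lambda & \text{if } x<0,\end{cases}\qquad \{x\}''_\lambda=x-\lfloor x\rfloor_\lambda .$$ Inserting a real number $y$ mod $P$ into $[0,P)$ means taking the unique element of $[0,P)$ that differs from $y$ by an integer multiple of $P$. The inserted values are counted with multiplicity, one for each pair $(i,m)$ with $1\le i\le d$ and $n_i<m\le N_i$, so the sequence $(b_n)$ has exactly $N$ terms and is increasing in the weak sense. Some points may coincide; coincident points with index pairs $(i,m)$ and $(j,n)$ are ordered by placing $(i,m)$ before $(j,n)$ if $i<j$, or if $i=j$ and $m<n$. *)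

theory Defs
  imports "HOL-Analysis.Analysis" "HOL-Library.Real_Mod"
begin

definition lattice_pts :: "real \<Rightarrow> real set" where
  "lattice_pts lam = {of_int n * lam | n. True}"

definition floor_lam :: "real \<Rightarrow> real \<Rightarrow> real" where
  "floor_lam lam x = (GREATEST r. r \<in> lattice_pts lam \<and> r \<le> x)"

definition ceiling_lam :: "real \<Rightarrow> real \<Rightarrow> real" where
  "ceiling_lam lam x = (LEAST r. r \<in> lattice_pts lam \<and> x \<le> r)"

definition frac_lam' :: "real \<Rightarrow> real \<Rightarrow> real" where
  "frac_lam' lam x = (if x \<ge> 0 then x - floor_lam lam x else x - ceiling_lam lam x)"

definition frac_lam'' :: "real \<Rightarrow> real \<Rightarrow> real" where
  "frac_lam'' lam x = x - floor_lam lam x"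

lemma floor_lam_eq:
  assumes "lam > 0"
  shows "floor_lam lam x = of_int \<lfloor>x / lam\<rfloor> * lam"
  unfolding floor_lam_def
  using assms
  by (intro Greatest_equality)
     (auto simp: lattice_pts_def le_floor_iff simp flip: pos_le_divide_eq)

lemma ceiling_lam_eq:
  assumes "lam > 0"
  shows "ceiling_lam lam x = of_int \<lceil>x / lam\<rceil> * lam"
  unfolding ceiling_lam_def
  using assms
  by (intro Least_equality)
     (auto simp: lattice_pts_def ceiling_le_iff simp flip: pos_divide_le_eq)

text \<open>
  Reduction of a real number \<open>y\<close> into \<open>[0,P)\<close> is the library's \<open>y rmod P\<close>.
\<close>

lemma rmod_eq_iff:
  assumes "P > 0"
  shows "y rmod P = z \<longleftrightarrow> 0 \<le> z \<and> z < P \<and> (\<exists>j::int. y - z = of_int j * P)"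
proof
  assume z: "y rmod P = z"
  then have "y - z = of_int \<lfloor>y / P\<rfloor> * P"
    using assms by (auto simp: rmod_def)
  then show "0 \<le> z \<and> z < P \<and> (\<exists>j::int. y - z = of_int j * P)"
    using z assms rmod_nonneg[of P y] rmod_less[of P y] by auto
next
  assume "0 \<le> z \<and> z < P \<and> (\<exists>j::int. y - z = of_int j * P)"
  then obtain j :: int where "0 \<le> z" "z < P" "y - z = of_int j * P" by blast
  then show "y rmod P = z"
    using assms by (intro rmod_unique[of _ _ _ j]) auto
qed

text \<open>
  The index pairs \<open>(i, m)\<close> with \<open>1 \<le> i \<le> d\<close> and \<open>n i < m \<le> N i\<close>, in lexicographic order.
\<close>

definition index_pairs :: "nat \<Rightarrow> (nat \<Rightarrow> nat) \<Rightarrow> (nat \<Rightarrow> nat) \<Rightarrow> (nat \<times> nat) list" where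
  "index_pairs d n N = concat (map (\<lambda>i. map (Pair i) [Suc (n i)..<Suc (N i)]) [1..<Suc d])"

definition inserted_value ::
    "real \<Rightarrow> real \<Rightarrow> (nat \<Rightarrow> real \<Rightarrow> real) \<Rightarrow> nat \<times> nat \<Rightarrow> real" where
  "inserted_value P \<alpha> f = (\<lambda>(i, m). f i (real m * \<alpha>) rmod P)"

text \<open>
  \<open>sort_key\<close> is stable, so coincident points stay in lexicographic order of their index pairs.
\<close>

definition sorted_pairs ::
    "real \<Rightarrow> real \<Rightarrow> (nat \<Rightarrow> real \<Rightarrow> real) \<Rightarrow> nat \<Rightarrow> (nat \<Rightarrow> nat) \<Rightarrow> (nat \<Rightarrow> nat) \<Rightarrow> (nat \<times> nat) list"
  where
  "sorted_pairs P \<alpha> f d n N = sort_key (inserted_value P \<alpha> f) (index_pairs d n N)"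

text \<open>
  The sequence is indexed from 1; it is only meaningful for indices between 1 and the number of
  index pairs.
\<close>

definition inserted_seq ::
    "real \<Rightarrow> real \<Rightarrow> (nat \<Rightarrow> real \<Rightarrow> real) \<Rightarrow> nat \<Rightarrow> (nat \<Rightarrow> nat) \<Rightarrow> (nat \<Rightarrow> nat) \<Rightarrow> nat \<Rightarrow> real"
  where
  "inserted_seq P \<alpha> f d n N r = inserted_value P \<alpha> f (sorted_pairs P \<alpha> f d n N ! (r - 1))"

lemma length_sorted_pairs:
  "length (sorted_pairs P \<alpha> f d n N) = (\<Sum>i=1..d. N i - n i)"
  by (simp add: sorted_pairs_def index_pairs_def length_concat comp_def interv_sum_list_conv_sum_set_nat
      atLeastLessThanSuc_atLeastAtMost del: upt_Suc)

definition gap :: "real \<Rightarrow> nat \<Rightarrow> (nat \<Rightarrow> real) \<Rightarrow> nat \<Rightarrow> real" where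
  "gap P M b m = (if m = 1 then P + b 1 - b M else b m - b (m - 1))"

end

theory Submission
  imports Defs
begin

text \<open>
  Put \<open>\<beta> = \<alpha> / q\<close>. Removing a multiple of \<open>\<lambda>\<close> from \<open>x\<close> changes \<open>p\<^sub>i / q * x\<close> by a multiple of
  \<open>P\<close>, so the inserted points are the residues mod \<open>P\<close> of \<open>p\<^sub>i m \<beta> + k\<^sub>i\<close>. Since \<open>p\<^sub>i c\<^sub>i = \<ell>\<close>, passing
  from \<open>m\<close> to \<open>m + c\<^sub>i\<close> moves a point by \<open>\<theta> = \<ell> \<beta>\<close>, whatever \<open>i\<close> is. The points thus split into at
  most \<open>c\<close> arithmetic progressions on the circle with the common step \<open>\<theta>\<close>, and the claim becomes the
  theorem of Chung and Graham that \<open>c\<close> such progressions leave at most \<open>3 c\<close> distinct gaps.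

  The argument is Liang's. Translate a gap again and again by \<open>\<theta>\<close>. As \<open>\<theta> / P\<close> is irrational, its
  left endpoint eventually leaves the finite set of points, so at some stage the translate of a gap
  is a gap no more. The length has not changed on the way, and it suffices to count the gaps whose
  translate is not a gap. For such a gap, either the left endpoint or the right endpoint is the last
  point of its progression, or some point \<open>w\<close> lies inside the translate; then \<open>w - \<theta>\<close> lies inside the
  gap and so is no point of the set, which makes \<open>w\<close> the first point of its progression. In
  each of the three cases the gap is determined by one end of a progression
  (\<open>card_gap_lengths_le\<close>), and there are at most \<open>c\<close> first and at most \<open>c\<close> last points
  (\<open>card_step_leaves_interval\<close>).

  Coincident points require care, since the length \<open>0\<close> counts as a gap as well. The circle is unrolled
  to a \<open>P\<close>-periodic set of pairs \<open>(x, i)\<close>, ordered lexicographically. Coincident points always have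
  different indices \<open>i\<close>, so all points become distinct, and translation, which acts on \<open>x\<close> only,
  preserves the order. A zero gap is then a gap like any other.
\<close>

section \<open>Consecutive points of a periodic set on the line\<close>

definition before :: "real \<times> 'i::linorder \<Rightarrow> real \<times> 'i \<Rightarrow> bool" where
  "before u v \<longleftrightarrow> fst u < fst v \<or> fst u = fst v \<and> snd u < snd v"

definition shift :: "real \<Rightarrow> real \<times> 'i \<Rightarrow> real \<times> 'i" where
  "shift t u = (fst u + t, snd u)"

definition consecutive :: "(real \<times> 'i::linorder) set \<Rightarrow> real \<times> 'i \<Rightarrow> real \<times> 'i \<Rightarrow> bool" where
  "consecutive L u v \<longleftrightarrow> u \<in> L \<and> v \<in> L \<and> before u v \<and> (\<forall>w\<in>L. \<not> (before u w \<and> before w v))"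

definition gap_lengths :: "(real \<times> 'i::linorder) set \<Rightarrow> real set" where
  "gap_lengths L = {fst v - fst u |u v. consecutive L u v}"

lemma before_trans: "before u v \<Longrightarrow> before v w \<Longrightarrow> before u w"
  by (auto simp: before_def)

lemma before_linear: "before u v \<or> u = v \<or> before v u"
  by (auto simp: before_def prod_eq_iff)

lemma before_shift [simp]: "before (shift t u) (shift t v) \<longleftrightarrow> before u v"
  by (simp add: before_def shift_def)

lemma shift_shift [simp]: "shift s (shift t u) = shift (t + s) u"
  by (simp add: shift_def add.assoc)

lemma shift_0 [simp]: "shift 0 u = u"
  by (simp add: shift_def)

lemma fst_shift [simp]: "fst (shift t u) = fst u + t"
  by (simp add: shift_def)

lemma consecutive_around_unique:
  assumes "consecutive L u v" "consecutive L u' v'"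
    and "before u w" "before w v" "before u' w" "before w v'"
  shows "u = u'" "v = v'"
  using assms before_trans before_linear unfolding consecutive_def by metis+

lemma consecutive_right_unique:
  assumes "consecutive L u v" "consecutive L u v'"
  shows "v = v'"
  using assms before_linear unfolding consecutive_def by metis

lemma consecutive_left_unique:
  assumes "consecutive L u v" "consecutive L u' v"
  shows "u = u'"
  using assms before_linear unfolding consecutive_def by metis

lemma consecutive_shift_period:
  assumes "\<And>u. shift t u \<in> L \<longleftrightarrow> u \<in> L" and "consecutive L u v"
  shows "consecutive L (shift t u) (shift t v)"
proof -
  have "\<not> (before (shift t u) w \<and> before w (shift t v))" if "w \<in> L" for w
  proof -
    have "shift (- t) w \<in> L" using assms(1)[of "shift (- t) w"] that by simp
    then have "\<not> (before u (shift (- t) w) \<and> before (shift (- t) w) v)"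
      using assms(2) by (simp add: consecutive_def)
    then show ?thesis
      using before_shift[of t u "shift (- t) w"] before_shift[of t "shift (- t) w" v] by simp
  qed
  then show ?thesis using assms by (simp add: consecutive_def)
qed

text \<open>
  The obstruction to translating a gap is always an end of a progression: a point \<open>w\<close> strictly inside
  the translated gap cannot have its predecessor \<open>w - \<theta>\<close> in \<open>L\<close>, since that one would lie strictly
  inside the original gap.
\<close>

lemma not_consecutive_shift_cases:
  assumes "consecutive L u v" "\<not> consecutive L (shift \<theta> u) (shift \<theta> v)"
  obtains "shift \<theta> u \<notin> L" | "shift \<theta> v \<notin> L"
  | w where "w \<in> L" "shift (- \<theta>) w \<notin> L" "before u (shift (- \<theta>) w)" "before (shift (- \<theta>) w) v"
proof (cases "shift \<theta> u \<in> L \<and> shift \<theta> v \<in> L")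
  case True
  then obtain w where w: "w \<in> L" "before (shift \<theta> u) w" "before w (shift \<theta> v)"
    using assms by (auto simp: consecutive_def)
  have "before u (shift (- \<theta>) w)" "before (shift (- \<theta>) w) v"
    using w(2,3) before_shift[of "- \<theta>" "shift \<theta> u" w] before_shift[of "- \<theta>" w "shift \<theta> v"]
    by simp_all
  moreover from this have "shift (- \<theta>) w \<notin> L"
    using assms(1) unfolding consecutive_def by blast
  ultimately show ?thesis using that(3) w(1) by blast
qed (use that(1,2) in blast)

text \<open>
  Follow a gap along its translates up to the last one that is still a gap; it exists because the
  left endpoint cannot stay in \<open>L\<close> forever.
\<close>

lemma gap_length_of_untranslatable_gap:
  assumes "g \<in> gap_lengths L"
    and escape: "\<And>u. u \<in> L \<Longrightarrow> \<exists>n::nat. shift (real n * \<theta>) u \<notin> L"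
  obtains u v where "consecutive L u v" "\<not> consecutive L (shift \<theta> u) (shift \<theta> v)"
    "g = fst v - fst u"
proof -
  obtain u v where uv: "consecutive L u v" "g = fst v - fst u"
    using assms(1) by (auto simp: gap_lengths_def)
  define C where
    "C n \<longleftrightarrow> consecutive L (shift (real n * \<theta>) u) (shift (real n * \<theta>) v)" for n :: nat
  have "C 0" using uv by (simp add: C_def)
  moreover have "\<exists>n. \<not> C n"
    using escape[of u] uv by (auto simp: C_def consecutive_def)
  ultimately obtain n where n: "C n" "\<not> C (Suc n)"
    using nat_induct[of C] by blast
  show ?thesis
    using that[of "shift (real n * \<theta>) u" "shift (real n * \<theta>) v"] n uv(2)
    by (simp add: C_def algebra_simps)
qed

text \<open>
  The sets \<open>A\<close> and \<open>B\<close> represent, up to the period \<open>P\<close>, the last and the first points of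
  the progressions. A last point may occur as a left or as a right endpoint, so \<open>A\<close> counts twice.
\<close>

theorem card_gap_lengths_le:
  fixes L :: "(real \<times> 'i::linorder) set"
  assumes period: "\<And>u (z::int). shift (of_int z * P) u \<in> L \<longleftrightarrow> u \<in> L"
    and escape: "\<And>u. u \<in> L \<Longrightarrow> \<exists>n::nat. shift (real n * \<theta>) u \<notin> L"
    and A: "finite A" "\<And>u. u \<in> L \<Longrightarrow> shift \<theta> u \<notin> L \<Longrightarrow> \<exists>z::int. shift (of_int z * P) u \<in> A"
    and B: "finite B" "\<And>w. w \<in> L \<Longrightarrow> shift (- \<theta>) w \<notin> L \<Longrightarrow> \<exists>z::int. shift (of_int z * P) w \<in> B"
  shows "finite (gap_lengths L)" and "card (gap_lengths L) \<le> 2 * card A + card B"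
proof -
  define gap_from where "gap_from u = (THE g. \<exists>v. consecutive L u v \<and> g = fst v - fst u)" for u
  define gap_to where "gap_to v = (THE g. \<exists>u. consecutive L u v \<and> g = fst v - fst u)" for v
  define gap_around where "gap_around w = (THE g. \<exists>u v. consecutive L u v \<and>
    before u (shift (- \<theta>) w) \<and> before (shift (- \<theta>) w) v \<and> g = fst v - fst u)" for w
  have from_eq: "gap_from u = fst v - fst u" if "consecutive L u v" for u v
    unfolding gap_from_def using that consecutive_right_unique by (intro the_equality) blast+
  have to_eq: "gap_to v = fst v - fst u" if "consecutive L u v" for u v
    unfolding gap_to_def using that consecutive_left_unique by (intro the_equality) blast+
  have around_eq: "gap_around w = fst v - fst u"
    if "consecutive L u v" "before u (shift (- \<theta>) w)" "before (shift (- \<theta>) w) v" for u v w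
    unfolding gap_around_def using that consecutive_around_unique
    by (intro the_equality) blast+
  \<comment> \<open>Moving a gap by a multiple of the period brings the responsible end point into \<open>A\<close> or \<open>B\<close>.\<close>
  have sub: "gap_lengths L \<subseteq> gap_from ` A \<union> gap_to ` A \<union> gap_around ` B"
  proof
    fix g assume "g \<in> gap_lengths L"
    then obtain u v where uv: "consecutive L u v" "\<not> consecutive L (shift \<theta> u) (shift \<theta> v)"
      and g: "g = fst v - fst u"
      using gap_length_of_untranslatable_gap[of g L \<theta>] escape by blast
    have L: "u \<in> L" "v \<in> L" using uv by (auto simp: consecutive_def)
    have moved: "consecutive L (shift (of_int z * P) u) (shift (of_int z * P) v)" for z :: int
      using consecutive_shift_period[OF _ uv(1)] period by blast
    from uv show "g \<in> gap_from ` A \<union> gap_to ` A \<union> gap_around ` B"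
    proof (cases rule: not_consecutive_shift_cases)
      case 1
      then obtain z :: int where "shift (of_int z * P) u \<in> A" using A(2) L by blast
      moreover have "g = gap_from (shift (of_int z * P) u)"
        using from_eq[OF moved[of z]] g by simp
      ultimately show ?thesis by blast
    next
      case 2
      then obtain z :: int where "shift (of_int z * P) v \<in> A" using A(2) L by blast
      moreover have "g = gap_to (shift (of_int z * P) v)"
        using to_eq[OF moved[of z]] g by simp
      ultimately show ?thesis by blast
    next
      case (3 w)
      then obtain z :: int where "shift (of_int z * P) w \<in> B" using B(2) by blast
      moreover have "shift (- \<theta>) (shift (of_int z * P) w) = shift (of_int z * P) (shift (- \<theta>) w)"
        by (simp add: add.commute)
      then have "g = gap_around (shift (of_int z * P) w)"
        using around_eq[OF moved[of z], of "shift (of_int z * P) w"] 3 g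
        by (simp only: before_shift fst_shift)
      ultimately show ?thesis by blast
    qed
  qed
  have fin: "finite (gap_from ` A \<union> gap_to ` A \<union> gap_around ` B)"
    using A(1) B(1) by simp
  then show "finite (gap_lengths L)"
    using sub finite_subset by blast
  have "card (gap_lengths L) \<le> card (gap_from ` A \<union> gap_to ` A \<union> gap_around ` B)"
    using sub fin by (rule card_mono[rotated])
  also have "\<dots> \<le> card (gap_from ` A \<union> gap_to ` A) + card (gap_around ` B)"
    by (rule card_Un_le)
  also have "\<dots> \<le> card (gap_from ` A) + card (gap_to ` A) + card (gap_around ` B)"
    by (simp add: card_Un_le)
  also have "\<dots> \<le> card A + card A + card B"
    by (intro add_mono card_image_le A B)
  finally show "card (gap_lengths L) \<le> 2 * card A + card B" by simp
qed

section \<open>Progressions with a common step\<close>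

text \<open>
  An element that a step \<open>e\<close> takes out of the interval lies within distance \<open>\<bar>e\<bar>\<close> of one end, namely
  the end towards which the step goes.
\<close>

lemma card_step_leaves_interval:
  fixes a b e :: int
  shows "int (card {m \<in> {a<..b}. m + e \<notin> {a<..b}}) \<le> \<bar>e\<bar>"
proof -
  define I where "I = (if e \<ge> 0 then {b - e<..b} else {a<..a - e})"
  have "card {m \<in> {a<..b}. m + e \<notin> {a<..b}} \<le> card I"
    by (rule card_mono) (auto simp: I_def)
  then show ?thesis by (auto simp: I_def split: if_splits)
qed

text \<open>
  The second component \<open>i\<close> keeps apart points of different index that coincide on the circle.
\<close>

definition unrolled_points ::
    "real \<Rightarrow> real \<Rightarrow> (nat \<Rightarrow> int) \<Rightarrow> (nat \<Rightarrow> real) \<Rightarrow> (nat \<times> int) set \<Rightarrow> (real \<times> nat) set" where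
  "unrolled_points P \<beta> p k S =
     {(of_int (p i * m) * \<beta> + k i + of_int z * P, i) |i m z. (i, m) \<in> S}"

text \<open>
  By irrationality a point determines its index pair: for a given \<open>i\<close>, two indices \<open>m\<close> giving the
  same point mod \<open>P\<close> are equal. This turns questions about translated points into questions about integers.
\<close>

lemma mem_unrolled_points_iff:
  assumes irr: "\<And>a z :: int. of_int a * \<beta> = of_int z * P \<Longrightarrow> a = 0" and "p i \<noteq> 0"
  shows "(of_int (p i * m) * \<beta> + k i + of_int z * P, i) \<in> unrolled_points P \<beta> p k S \<longleftrightarrow> (i, m) \<in> S"
proof
  assume "(of_int (p i * m) * \<beta> + k i + of_int z * P, i) \<in> unrolled_points P \<beta> p k S"
  then obtain m' z' where *: "(i, m') \<in> S"
    "of_int (p i * m) * \<beta> + k i + of_int z * P = of_int (p i * m') * \<beta> + k i + of_int z' * P"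
    by (auto simp: unrolled_points_def)
  from *(2) have "of_int (p i * m - p i * m') * \<beta> = of_int (z' - z) * P"
    by (simp add: algebra_simps)
  from irr[OF this] assms(2) have "m = m'" by simp
  with *(1) show "(i, m) \<in> S" by simp
qed (auto simp: unrolled_points_def)

text \<open>
  The theorem of Chung and Graham for progressions given in residue classes: the points with
  index \<open>i\<close> form at most \<open>\<bar>c i\<bar>\<close> progressions with step \<open>l \<beta>\<close>, one for each residue of \<open>m\<close> modulo
  \<open>c i\<close>, and a negative \<open>c i\<close> means that \<open>m\<close> decreases along them. The irrationality of \<open>\<beta> / P\<close> is
  stated as the absence of nontrivial relations \<open>a \<beta> = z P\<close>.
\<close>

theorem card_gap_lengths_unrolled_points_le:
  fixes n N :: "nat \<Rightarrow> nat" and p c :: "nat \<Rightarrow> int" and l :: int and k :: "nat \<Rightarrow> real"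
  assumes irr: "\<And>a z :: int. of_int a * \<beta> = of_int z * P \<Longrightarrow> a = 0"
    and p: "\<And>i. i \<in> I \<Longrightarrow> p i \<noteq> 0" and c: "\<And>i. i \<in> I \<Longrightarrow> p i * c i = l"
    and "l \<noteq> 0" and "finite I"
  defines "L \<equiv> unrolled_points P \<beta> p k (SIGMA i:I. {int (n i)<..int (N i)})"
  shows "finite (gap_lengths L)" and "int (card (gap_lengths L)) \<le> 3 * (\<Sum>i\<in>I. \<bar>c i\<bar>)"
proof -
  define S where "S = (SIGMA i:I. {int (n i)<..int (N i)})"
  define \<theta> where "\<theta> = of_int l * \<beta>"
  define pt where "pt i m z = (of_int (p i * m) * \<beta> + k i + of_int z * P, i)" for i and m z :: int
  define last where "last = (SIGMA i:I. {m \<in> {int (n i)<..int (N i)}. m + c i \<notin> {int (n i)<..int (N i)}})"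
  define first where "first = (SIGMA i:I. {m \<in> {int (n i)<..int (N i)}. m - c i \<notin> {int (n i)<..int (N i)}})"
  define A where "A = (\<lambda>(i, m). pt i m 0) ` last"
  define B where "B = (\<lambda>(i, m). pt i m 0) ` first"
  have L: "u \<in> L \<longleftrightarrow> (\<exists>i m z. (i, m) \<in> S \<and> u = pt i m z)" for u
    by (auto simp: L_def unrolled_points_def pt_def S_def)
  have pt_L: "pt i m z \<in> L \<longleftrightarrow> (i, m) \<in> S" if "i \<in> I" for i m z
    unfolding pt_def L_def S_def by (rule mem_unrolled_points_iff[where p = p, OF irr p[OF that]])
  have S_I: "i \<in> I" if "(i, m) \<in> S" for i m using that by (auto simp: S_def)
  have step: "shift (of_int e * \<theta>) (pt i m z) = pt i (m + e * c i) z" if "i \<in> I" for e i m z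
    using c[OF that] by (auto simp: shift_def pt_def \<theta>_def algebra_simps)
  have turn: "shift (of_int y * P) (pt i m z) = pt i m (z + y)" for y i m z
    by (simp add: shift_def pt_def algebra_simps)
  have fwd: "shift \<theta> (pt i m z) = pt i (m + c i) z"
    and bwd: "shift (- \<theta>) (pt i m z) = pt i (m - c i) z" if "i \<in> I" for i m z
    using step[OF that, of 1] step[OF that, of "- 1"] by simp_all
  have c0: "c i \<noteq> 0" if "i \<in> I" for i using c[OF that] \<open>l \<noteq> 0\<close> by auto

  have fin: "finite last" "finite first"
    using \<open>finite I\<close>
    by (auto simp: last_def first_def intro!: finite_SigmaI intro: finite_subset[OF _ finite_greaterThanAtMost_int])
  have period: "shift (of_int z * P) u \<in> L \<longleftrightarrow> u \<in> L" for u and z :: int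
  proof
    assume "shift (of_int z * P) u \<in> L"
    then obtain i m y where *: "(i, m) \<in> S" "shift (of_int z * P) u = pt i m y" by (auto simp: L)
    have "u = shift (of_int (- z) * P) (shift (of_int z * P) u)" by simp
    also have "\<dots> = pt i m (y + - z)" using *(2) turn by metis
    finally show "u \<in> L" using *(1) L by blast
  qed (use L turn in metis)
  \<comment> \<open>Since \<open>m\<close> lies in \<open>{1..N i}\<close>, adding a nonzero \<open>c i\<close> altogether \<open>N i\<close> times leads out of it.\<close>
  have escape: "\<exists>e::nat. shift (real e * \<theta>) u \<notin> L" if "u \<in> L" for u
  proof -
    obtain i m z where *: "(i, m) \<in> S" "u = pt i m z" using \<open>u \<in> L\<close> L by blast
    have m: "0 < m" "m \<le> int (N i)" using * by (auto simp: S_def)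
    have "m + int (N i) * c i \<notin> {int (n i)<..int (N i)}"
    proof (cases "c i > 0")
      case True
      then have "int (N i) * 1 \<le> int (N i) * c i" by (intro mult_left_mono) auto
      with m show ?thesis unfolding greaterThanAtMost_iff by linarith
    next
      case False
      then have "c i \<le> -1" using c0 S_I * by force
      then have "int (N i) * c i \<le> int (N i) * -1" by (intro mult_left_mono) auto
      with m show ?thesis unfolding greaterThanAtMost_iff by linarith
    qed
    then have "shift (of_int (int (N i)) * \<theta>) u \<notin> L"
      using * step[of i "int (N i)" m z] pt_L S_I by (auto simp: S_def)
    then show ?thesis by auto
  qed
  have A: "\<exists>z::int. shift (of_int z * P) u \<in> A" if "u \<in> L" "shift \<theta> u \<notin> L" for u
  proof -
    obtain i m z where *: "(i, m) \<in> S" "u = pt i m z" using \<open>u \<in> L\<close> L by blast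
    then have "(i, m) \<in> last"
      using that(2) S_I pt_L fwd by (auto simp: last_def S_def)
    then have "shift (of_int (- z) * P) u \<in> A"
      unfolding A_def *(2) turn by force
    then show ?thesis by blast
  qed
  have B: "\<exists>z::int. shift (of_int z * P) u \<in> B" if "u \<in> L" "shift (- \<theta>) u \<notin> L" for u
  proof -
    obtain i m z where *: "(i, m) \<in> S" "u = pt i m z" using \<open>u \<in> L\<close> L by blast
    then have "(i, m) \<in> first"
      using that(2) S_I pt_L bwd by (auto simp: first_def S_def)
    then have "shift (of_int (- z) * P) u \<in> B"
      unfolding B_def *(2) turn by force
    then show ?thesis by blast
  qed
  have AB: "finite A" "finite B" using fin by (auto simp: A_def B_def)
  show "finite (gap_lengths L)"
    using card_gap_lengths_le(1)[OF period escape AB(1) A AB(2) B] .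
  have "int (card A) \<le> int (card last)"
    unfolding A_def using card_image_le[OF fin(1)] by simp
  also have "\<dots> \<le> (\<Sum>i\<in>I. \<bar>c i\<bar>)"
    unfolding last_def using \<open>finite I\<close>
    by (subst card_SigmaI) (auto simp del: greaterThanAtMost_iff intro!: sum_mono card_step_leaves_interval)
  finally have cA: "int (card A) \<le> (\<Sum>i\<in>I. \<bar>c i\<bar>)" .
  have "int (card B) \<le> int (card first)"
    unfolding B_def using card_image_le[OF fin(2)] by simp
  also have "\<dots> \<le> (\<Sum>i\<in>I. \<bar>c i\<bar>)"
  proof -
    have "int (card {m \<in> {int (n i)<..int (N i)}. m - c i \<notin> {int (n i)<..int (N i)}}) \<le> \<bar>c i\<bar>" for i
      using card_step_leaves_interval[of "int (n i)" "int (N i)" "- c i"] by simp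
    then show ?thesis
      unfolding first_def using \<open>finite I\<close>
      by (subst card_SigmaI) (auto simp del: greaterThanAtMost_iff intro!: sum_mono)
  qed
  finally have "int (card B) \<le> (\<Sum>i\<in>I. \<bar>c i\<bar>)" .
  then show "int (card (gap_lengths L)) \<le> 3 * (\<Sum>i\<in>I. \<bar>c i\<bar>)"
    using card_gap_lengths_le(2)[OF period escape AB(1) A AB(2) B] cA by linarith
qed

section \<open>Gaps of the sorted sequence\<close>

text \<open>
  Stability means that the elements with a given key keep their original order, so an order \<open>R\<close>
  present before sorting breaks the ties afterwards.
\<close>

lemma sorted_wrt_sort_key_stable:
  assumes "sorted_wrt R xs"
  shows "sorted_wrt (\<lambda>a b. f a < f b \<or> f a = f b \<and> R a b) (sort_key f xs)"
proof -
  have "sorted_wrt (\<lambda>a b. f a < f b \<or> f a = f b \<and> R a b) ys"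
    if "sorted (map f ys)" "\<And>x. sorted_wrt R (filter (\<lambda>y. f y = x) ys)" for ys
    using that
  proof (induction ys)
    case (Cons y ys)
    have "sorted_wrt R (filter (\<lambda>y. f y = x) ys)" for x
      using Cons.prems(2)[of x] by (simp split: if_splits)
    moreover have "\<forall>b\<in>set ys. f b = f y \<longrightarrow> R y b"
      using Cons.prems(2)[of "f y"] by simp
    ultimately show ?case using Cons by fastforce
  qed simp
  moreover have "sorted_wrt R (filter (\<lambda>y. f y = x) (sort_key f xs))" for x
    using assms by (simp add: sort_key_stable sorted_wrt_filter)
  ultimately show ?thesis by simp
qed

lemma sorted_wrt_index_pairs:
  "sorted_wrt (\<lambda>s t. fst s < fst t \<or> fst s = fst t \<and> snd s < snd t) (index_pairs d n N)"
proof -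
  let ?R = "\<lambda>s t :: nat \<times> nat. fst s < fst t \<or> fst s = fst t \<and> snd s < snd t"
  have "sorted_wrt ?R (concat (map (\<lambda>i. map (Pair i) [Suc (n i)..<Suc (N i)]) is))"
    if "sorted_wrt (<) is" for "is"
    using that
    by (induction "is") (auto simp: sorted_wrt_append sorted_wrt_map simp del: upt_Suc)
  then show ?thesis unfolding index_pairs_def by (simp del: upt_Suc)
qed

lemma set_index_pairs:
  "set (index_pairs d n N) = (SIGMA i:{1..d}. {n i<..N i})"
  by (auto simp: index_pairs_def image_iff simp del: upt_Suc)

text \<open>
  The gap numbered \<open>1\<close> becomes an ordinary gap after unrolling, from the last point to the
  translate by \<open>P\<close> of the first.
\<close>

lemma gap_in_gap_lengths_of_strictly_sorted:
  fixes xs :: "(real \<times> 'i::linorder) list"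
  assumes sorted: "sorted_wrt before xs"
    and range: "\<And>u. u \<in> set xs \<Longrightarrow> 0 \<le> fst u \<and> fst u < P"
    and b: "\<And>r. r \<in> {1..length xs} \<Longrightarrow> b r = fst (xs ! (r - 1))"
    and m: "m \<in> {1..length xs}"
  shows "gap P (length xs) b m \<in> gap_lengths {shift (of_int z * P) u |u (z::int). u \<in> set xs}"
    (is "_ \<in> gap_lengths ?L")
proof -
  have mono: "s < t" if "before (xs ! s) (xs ! t)" "s < length xs" "t < length xs" for s t
  proof (rule ccontr)
    assume "\<not> s < t"
    then have "s = t \<or> t < s" by auto
    then have "s = t \<or> before (xs ! t) (xs ! s)"
      using sorted that by (auto simp: sorted_wrt_iff_nth_less)
    then show False using that(1) by (auto simp: before_def)
  qed
  have period_L: "shift (of_int z * P) (xs ! t) \<in> ?L" if "t < length xs" for t and z :: int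
    using that nth_mem by blast
  have nth_L: "xs ! t \<in> ?L" "shift P (xs ! t) \<in> ?L" if "t < length xs" for t
    using period_L[OF that, of 0] period_L[OF that, of 1] by simp_all
  have "xs ! 0 \<in> set xs" using m by (intro nth_mem) auto
  then have P: "P > 0" using range[of "xs ! 0"] by linarith
  show ?thesis
  proof (cases "m = 1")
    case False
    define r where "r = m - 2"
    have r: "Suc r < length xs" "m = Suc (Suc r)" using m False by (auto simp: r_def)
    have "\<not> (before (xs ! r) w \<and> before w (xs ! Suc r))" if "w \<in> ?L" for w
    proof
      \<comment> \<open>Such a \<open>w\<close> lies in \<open>[0,P)\<close>, hence is an element of \<open>xs\<close> between neighbours.\<close>
      assume w: "before (xs ! r) w \<and> before w (xs ! Suc r)"
      obtain u and z :: int where u: "w = shift (of_int z * P) u" "u \<in> set xs" using \<open>w \<in> ?L\<close> by blast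
      have "0 \<le> fst w" "fst w < P"
        using w range[of "xs ! r"] range[of "xs ! Suc r"] r by (auto simp: before_def)
      then have "-1 * P < of_int z * P" "of_int z * P < 1 * P"
        using range[OF u(2)] unfolding u(1) fst_shift by linarith+
      then have "z = 0" using P by (simp only: mult_less_cancel_right_pos)
      then obtain t where "t < length xs" "w = xs ! t" using u by (auto simp: in_set_conv_nth)
      then show False using mono[of r t] mono[of t "Suc r"] w r by auto
    qed
    moreover have "before (xs ! r) (xs ! Suc r)"
      using sorted r by (simp add: sorted_wrt_iff_nth_less)
    ultimately have "consecutive ?L (xs ! r) (xs ! Suc r)"
      using nth_L r by (auto simp: consecutive_def)
    moreover have "gap P (length xs) b m = fst (xs ! Suc r) - fst (xs ! r)"
      using r b[of m] b[of "m - 1"] by (simp add: gap_def)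
    ultimately show ?thesis unfolding gap_lengths_def by blast
  next
    case True
    define r where "r = length xs - 1"
    have r: "r < length xs" "0 < length xs" using m True by (auto simp: r_def)
    have "\<not> (before (xs ! r) w \<and> before w (shift P (xs ! 0)))" if "w \<in> ?L" for w
    proof
      \<comment> \<open>Such a \<open>w\<close> lies in \<open>[0,2P)\<close>: it is an element after the last one, or the translate by \<open>P\<close>
        of an element before the first one.\<close>
      assume w: "before (xs ! r) w \<and> before w (shift P (xs ! 0))"
      obtain u and z :: int where u: "w = shift (of_int z * P) u" "u \<in> set xs" using \<open>w \<in> ?L\<close> by blast
      obtain t where t: "t < length xs" "u = xs ! t" using u by (auto simp: in_set_conv_nth)
      have "0 \<le> fst w" "fst w < 2 * P"
        using w range[of "xs ! r"] range[of "xs ! 0"] r by (auto simp: before_def)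
      then have "-1 * P < of_int z * P" "of_int z * P < 2 * P"
        using range[OF u(2)] unfolding u(1) fst_shift by linarith+
      then have "z = 0 \<or> z = 1" using P by (simp only: mult_less_cancel_right_pos) auto
      then show False
      proof
        assume "z = 0"
        then show False using mono[of r t] w u t r by (auto simp: r_def)
      next
        assume "z = 1"
        then show False using mono[of t 0] w u t r by auto
      qed
    qed
    moreover have "before (xs ! r) (shift P (xs ! 0))"
      using range[of "xs ! r"] range[of "xs ! 0"] r by (auto simp: before_def)
    ultimately have "consecutive ?L (xs ! r) (shift P (xs ! 0))"
      using nth_L r by (auto simp: consecutive_def)
    moreover have "gap P (length xs) b m = fst (shift P (xs ! 0)) - fst (xs ! r)"
      using r True b[of 1] b[of "length xs"] by (simp add: gap_def r_def)
    ultimately show ?thesis unfolding gap_lengths_def by blast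
  qed
qed

lemma frac_lam_eq_minus_multiple:
  assumes "lam > 0" "frac_part = frac_lam' lam \<or> frac_part = frac_lam'' lam"
  obtains z :: int where "frac_part x = x - of_int z * lam"
  using assms(2) that[of "\<lfloor>x / lam\<rfloor>"] that[of "\<lceil>x / lam\<rceil>"]
  by (cases "x \<ge> 0")
     (auto simp: frac_lam'_def frac_lam''_def floor_lam_eq[OF assms(1)] ceiling_lam_eq[OF assms(1)])

theorem theorem1p1:
  fixes \<alpha> P lam :: real
    and d :: nat
    and n N :: "nat \<Rightarrow> nat"
    and q :: int
    and p :: "nat \<Rightarrow> int"
    and k :: "nat \<Rightarrow> real"
    and frac_part :: "real \<Rightarrow> real"
  assumes "\<alpha> > 0" and "\<alpha> \<notin> \<rat>"
    and "d \<ge> 1"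
    and "\<And>i. 1 \<le> i \<Longrightarrow> i \<le> d \<Longrightarrow> 0 < N i"
    and "\<And>i. 1 \<le> i \<Longrightarrow> i \<le> d \<Longrightarrow> n i \<le> N i"
    and "q > 0"
    and "\<And>i. 1 \<le> i \<Longrightarrow> i \<le> d \<Longrightarrow> p i \<noteq> 0"
    and "P > 0" and "P \<in> \<rat>"
    and "\<exists>j::nat. j > 0 \<and> lam = real j * (P * real_of_int q)"
    and "frac_part = frac_lam' lam \<or> frac_part = frac_lam'' lam"
  shows
    "let Ntot = (\<Sum>i=1..d. N i - n i);
         fhat = (\<lambda>i x. real_of_int (p i) / real_of_int q * x + k i);
         f = (\<lambda>i x. fhat i (frac_part x));
         b = inserted_seq P \<alpha> f d n N;
         l = (LCM i\<in>{1..d}. p i);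
         c = (\<Sum>i=1..d. \<bar>l div p i\<bar>)
     in int (card (gap P Ntot b ` {1..Ntot})) \<le> 3 * c"
proof -
  define f where "f = (\<lambda>i x. real_of_int (p i) / real_of_int q * frac_part x + k i)"
  define l where "l = (LCM i\<in>{1..d}. p i)"
  define c where "c i = l div p i" for i
  define \<beta> where "\<beta> = \<alpha> / of_int q"
  define val where "val = inserted_value P \<alpha> f"
  define sl where "sl = sorted_pairs P \<alpha> f d n N"
  define xs where "xs = map (\<lambda>s. (val s, fst s)) sl"
  define L where "L = unrolled_points P \<beta> p k (SIGMA i:{1..d}. {int (n i)<..int (N i)})"
  obtain j where lam: "lam = real j * (P * of_int q)" "j > 0"
    using assms(10) by blast
  have lam_pos: "lam > 0" using lam \<open>P > 0\<close> \<open>q > 0\<close> by simp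
  have p0: "p i \<noteq> 0" if "i \<in> {1..d}" for i using assms(7) that by simp
  have c: "p i * c i = l" if "i \<in> {1..d}" for i
    unfolding c_def l_def using that by (intro dvd_mult_div_cancel dvd_Lcm) simp
  have l0: "l \<noteq> 0"
    unfolding l_def using p0 by (subst Lcm_0_iff) auto
  have irr: "a = 0" if "of_int a * \<beta> = of_int z * P" for a z :: int
  proof (rule ccontr)
    assume "a \<noteq> 0"
    then have "\<alpha> = of_int z * P * of_int q / of_int a"
      using that \<open>q > 0\<close> by (simp add: \<beta>_def field_simps)
    also have "\<dots> \<in> \<rat>" using \<open>P \<in> \<rat>\<close> by simp
    finally show False using assms(2) by blast
  qed

  have val: "\<exists>z::int. val (i, m) = of_int (p i * int m) * \<beta> + k i + of_int z * P" for i m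
  proof -
    obtain y :: int where y: "frac_part (real m * \<alpha>) = real m * \<alpha> - of_int y * lam"
      using frac_lam_eq_minus_multiple[OF lam_pos assms(11)] by blast
    have "f i (real m * \<alpha>) = of_int (p i * int m) * \<beta> + k i - of_int (p i * y * int j) * P"
      unfolding f_def y using \<open>q > 0\<close> by (simp add: \<beta>_def lam(1) field_simps)
    moreover obtain x :: int where "f i (real m * \<alpha>) - val (i, m) = of_int x * P"
      using rmod_eq_iff[OF \<open>P > 0\<close>, of "f i (real m * \<alpha>)" "val (i, m)"]
      by (auto simp: val_def inserted_value_def)
    ultimately have
      "val (i, m) = of_int (p i * int m) * \<beta> + k i + of_int (- (p i * y * int j) - x) * P"
      by (simp add: algebra_simps)
    then show ?thesis by blast
  qed
  have val_range: "0 \<le> val s \<and> val s < P" for s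
    using rmod_nonneg rmod_less \<open>P > 0\<close>
    by (simp add: val_def inserted_value_def split: prod.split)
  have set_sl: "set sl = (SIGMA i:{1..d}. {n i<..N i})"
    by (simp add: sl_def sorted_pairs_def set_index_pairs)

  have L_xs: "L = {shift (of_int z * P) u |u (z::int). u \<in> set xs}"
  proof (intro equalityI subsetI)
    fix w assume "w \<in> L"
    then obtain i m z where w: "i \<in> {1..d}" "int (n i) < m" "m \<le> int (N i)"
      "w = (of_int (p i * m) * \<beta> + k i + of_int z * P, i)"
      by (auto simp: L_def unrolled_points_def)
    obtain y :: int where "val (i, nat m) = of_int (p i * m) * \<beta> + k i + of_int y * P"
      using val[of i "nat m"] w by auto
    then have "w = shift (of_int (z - y) * P) (val (i, nat m), i)"
      by (simp add: w shift_def algebra_simps)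
    moreover have "(i, nat m) \<in> set sl" using w by (auto simp: set_sl)
    then have "(val (i, nat m), i) \<in> set xs" by (force simp: xs_def)
    ultimately show "w \<in> {shift (of_int z * P) u |u (z::int). u \<in> set xs}" by blast
  next
    fix w assume "w \<in> {shift (of_int z * P) u |u (z::int). u \<in> set xs}"
    then obtain i m and z :: int where w: "(i, m) \<in> set sl" "w = shift (of_int z * P) (val (i, m), i)"
      by (auto simp: xs_def)
    obtain y :: int where "val (i, m) = of_int (p i * int m) * \<beta> + k i + of_int y * P"
      using val by blast
    then have "w = (of_int (p i * int m) * \<beta> + k i + of_int (z + y) * P, i)"
      by (simp add: w shift_def algebra_simps)
    moreover have "(i, int m) \<in> (SIGMA i:{1..d}. {int (n i)<..int (N i)})"
      using w(1) by (auto simp: set_sl)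
    ultimately show "w \<in> L" unfolding L_def unrolled_points_def by blast
  qed

  \<comment> \<open>Coincident points with the same \<open>i\<close> do not occur, so the lexicographic order of the index pairs,
    which resolves ties in the sequence, does so by \<open>i\<close> alone, as \<open>before\<close> does.\<close>
  have inj: "m = m'" if eq: "val (i, m) = val (i, m')" and "i \<in> {1..d}" for i m m'
  proof -
    obtain z z' :: int where
      "of_int (p i * int m) * \<beta> + k i + of_int z * P = of_int (p i * int m') * \<beta> + k i + of_int z' * P"
      using val[of i m] val[of i m'] eq by metis
    then have "of_int (p i * int m - p i * int m') * \<beta> = of_int (z' - z) * P"
      by (simp add: algebra_simps)
    from irr[OF this] p0[OF \<open>i \<in> {1..d}\<close>] show ?thesis by simp
  qed
  have "sorted_wrt (\<lambda>s t. val s < val t \<or>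
      val s = val t \<and> (fst s < fst t \<or> fst s = fst t \<and> snd s < snd t)) sl"
    unfolding sl_def sorted_pairs_def val_def
    by (rule sorted_wrt_sort_key_stable[OF sorted_wrt_index_pairs])
  then have "sorted_wrt (\<lambda>s t. before (val s, fst s) (val t, fst t)) sl"
  proof (rule sorted_wrt_mono_rel[rotated])
    fix s t assume "s \<in> set sl" and "val s < val t \<or>
      val s = val t \<and> (fst s < fst t \<or> fst s = fst t \<and> snd s < snd t)"
    moreover from this have "fst s \<in> {1..d}" by (auto simp: set_sl)
    ultimately show "before (val s, fst s) (val t, fst t)"
      using inj[of "fst s" "snd s" "snd t"] by (auto simp: before_def)
  qed
  then have sorted: "sorted_wrt before xs" by (simp add: xs_def sorted_wrt_map)

  define M where "M = (\<Sum>i=1..d. N i - n i)"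
  have M: "M = length xs"
    unfolding M_def xs_def sl_def by (simp add: length_sorted_pairs)
  have "gap P M (inserted_seq P \<alpha> f d n N) m \<in> gap_lengths L" if "m \<in> {1..M}" for m
    unfolding L_xs M
  proof (rule gap_in_gap_lengths_of_strictly_sorted[OF sorted])
    show "0 \<le> fst u \<and> fst u < P" if "u \<in> set xs" for u
      using that val_range by (auto simp: xs_def)
    show "inserted_seq P \<alpha> f d n N r = fst (xs ! (r - 1))" if "r \<in> {1..length xs}" for r
      using that by (auto simp: inserted_seq_def xs_def sl_def val_def)
    show "m \<in> {1..length xs}" using \<open>m \<in> {1..M}\<close> M by simp
  qed
  then have sub: "gap P M (inserted_seq P \<alpha> f d n N) ` {1..M} \<subseteq> gap_lengths L" by blast
  have gaps: "finite (gap_lengths L)" "int (card (gap_lengths L)) \<le> 3 * (\<Sum>i=1..d. \<bar>c i\<bar>)"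
    unfolding L_def
    by (rule card_gap_lengths_unrolled_points_le[where p = p and c = c and l = l];
        (erule irr p0 c | rule l0 finite_atLeastAtMost))+
  have "int (card (gap P M (inserted_seq P \<alpha> f d n N) ` {1..M})) \<le> int (card (gap_lengths L))"
    using card_mono[OF gaps(1) sub] by simp
  also have "\<dots> \<le> 3 * (\<Sum>i=1..d. \<bar>c i\<bar>)" by (rule gaps(2))
  finally show ?thesis
    by (simp add: Let_def M_def f_def c_def l_def)
qed

end
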